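(* In the setting described in the context, Algorithm 1 and Algorithm 2 are equivalent: the iterate sequence of either algorithm exactly corresponds to an iterate sequence of the other. Precisely, fix step-size sequences $\{\alpha_i\},\{\eta_i\}\subset(0,1]$ and an index sequence $j_0,j_1,\dots\in\{1,\dots,n\}$. If $(s^i,d^i,\tilde\beta^i,\bar\beta^i)_{i\ge0}$ is an iterate sequence of Algorithm 1 with these step-sizes and indices, then $(w^i,\tilde\beta^i,\bar\beta^i)_{i\ge0}$ with $w^i:=\nabla L(s^i)$ is an iterate sequence of Algorithm 2 with the same step-sizes and indices. Conversely, if $(w^i,\tilde\beta^i,\bar\beta^i)_{i\ge0}$ is an iterate sequence of Algorithm 2 with these step-sizes and indices, then $(s^i,d^i,\tilde\beta^i,\bar\beta^i)_{i\ge0}$ with $s^i:=\nabla L^*(w^i)$ and $d^i:=\frac1nX^Tw^i$ is an iterate sequence of Algorithm 1 with the same step-sizes and indices.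
   Context: Setting. Let $n,p\ge1$, $x_1,\dots,x_n\in\mathbb R^p$, and let $X\in\mathbb R^{n\times p}$ be the matrix whose $j$-th row is $x_j^T$. For $j=1,\dots,n$, $l_j:\mathbb R\to\mathbb R$ is strictly convex and $\gamma$-smooth, i.e. differentiable with derivative $\dot l_j$ satisfying $|\dot l_j(a)-\dot l_j(b)|\le\gamma|a-b|$ for all $a,b$. $R:\mathbb R^p\to\mathbb R\cup\{+\infty\}$ is a function such that $\operatorname{dom}R=\{\beta: R(\beta)<+\infty\}$ is bounded and contains $0$, and $\min_\beta c^T\beta+R(\beta)$ is attained for every $c\in\mathbb R^p$. Conjugates: $f^*(y)=\sup_x\{y^Tx-f(x)\}$. Each $l_j^*$ is differentiable on the range of $\dot l_j$ (the interior of its domain), with derivative $\dot l_j^*$. Put $L(s)=\sum_j l_j(s_j)$ and $L^*(w)=\sum_j l_j^*(w_j)$. $h(w)=\frac1n\sum_{j=1}^n l_j^*(w_j)$, and $D_h(w_1,w_2)=h(w_1)-h(w_2)-\langle\nabla h(w_2),w_1-w_2\rangle$ is its Bregman distance. Algorithm 1 (Stochastic Generalized Frank-Wolfe with substitute gradient). Initialize $\bar\beta^{-1}=0$, $s^0=0\in\mathbb R^n$, $d^0=\frac1nX^T\nabla L(s^0)$. For $i=0,1,\dots$: compute some $\tilde\beta^i\in\arg\min_\beta\{(d^i)^T\beta+R(\beta)\}$; choose $j_i$ (uniformly at random) in $\{1,\dots,n\}$; set $s^{i+1}_{j_i}=(1-\eta_i)s^i_{j_i}+\eta_i x_{j_i}^T\tilde\beta^i$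 and $s^{i+1}_j=s^i_j$ for $j\ne j_i$; set $d^{i+1}=\frac1nX^T\nabla L(s^{i+1})=d^i+\frac1n\big(\dot l_{j_i}(s^{i+1}_{j_i})-\dot l_{j_i}(s^i_{j_i})\big)x_{j_i}$; set $\bar\beta^i=(1-\alpha_i)\bar\beta^{i-1}+\alpha_i\tilde\beta^i$. Algorithm 2 (Randomized Coordinate Mirror Descent applied to the dual problem). Initialize $w^0=\arg\min_w h(w)$, $\bar\beta^{-1}=0$. For $i=0,1,\dots$: compute some $\tilde\beta^i\in\arg\min_\beta\{\frac1n(w^i)^TX\beta+R(\beta)\}$; choose $j_i$ (uniformly at random) in $\{1,\dots,n\}$; set $\tilde g^i=\frac1n\big(x_{j_i}^T\tilde\beta^i-\dot l^*_{j_i}(w^i_{j_i})\big)e_{j_i}$, with $e_j$ the $j$-th unit vector of $\mathbb R^n$; set $w^{i+1}=\arg\min_w\{\langle-\eta_i\tilde g^i,w-w^i\rangle+D_h(w,w^i)\}$; set $\bar\beta^i=(1-\alpha_i)\bar\beta^{i-1}+\alpha_i\tilde\beta^i$. *)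

theory Defs
  imports "HOL-Analysis.Analysis"
begin

definition strictly_convex :: "(real \<Rightarrow> real) \<Rightarrow> bool" where
  "strictly_convex f \<longleftrightarrow>
     (\<forall>a b t. a \<noteq> b \<longrightarrow> 0 < t \<longrightarrow> t < 1 \<longrightarrow>
        f ((1 - t) * a + t * b) < (1 - t) * f a + t * f b)"

definition smooth_with :: "real \<Rightarrow> (real \<Rightarrow> real) \<Rightarrow> bool" where
  "smooth_with \<gamma> f \<longleftrightarrow>
     (\<forall>a. f differentiable at a) \<and> (\<forall>a b. \<bar>deriv f a - deriv f b\<bar> \<le> \<gamma> * \<bar>a - b\<bar>)"

definition eff_dom :: "('a \<Rightarrow> ereal) \<Rightarrow> 'a set" where
  "eff_dom f = {x. f x < \<infinity>}"

definition argmin_set :: "('a \<Rightarrow> ereal) \<Rightarrow> 'a set" where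
  "argmin_set f = {x. is_arg_min f (\<lambda>_. True) x}"

definition conjugate :: "('a::real_inner \<Rightarrow> real) \<Rightarrow> 'a \<Rightarrow> ereal" where
  "conjugate f y = (SUP x. ereal (y \<bullet> x - f x))"

definition grad :: "('a::real_inner \<Rightarrow> real) \<Rightarrow> 'a \<Rightarrow> 'a" where
  "grad f x = (THE D. GDERIV f x :> D)"

text \<open>
  Extended-valued functions are differentiated through \<^const>\<open>real_of_ereal\<close>. This agrees with
  the usual notion at interior points of the effective domain, the only points where
  \<open>egrad\<close> and \<open>ederiv\<close> are meaningful.
\<close>

definition egrad :: "('a::real_inner \<Rightarrow> ereal) \<Rightarrow> 'a \<Rightarrow> 'a" where
  "egrad f = grad (\<lambda>x. real_of_ereal (f x))"

definition ederiv :: "(real \<Rightarrow> ereal) \<Rightarrow> real \<Rightarrow> real" where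
  "ederiv f = deriv (\<lambda>x. real_of_ereal (f x))"

definition bregman :: "('a::real_inner \<Rightarrow> ereal) \<Rightarrow> 'a \<Rightarrow> 'a \<Rightarrow> ereal" where
  "bregman f w1 w2 = f w1 - f w2 - ereal (egrad f w2 \<bullet> (w1 - w2))"

text \<open>
  The number of samples is \<open>CARD('n)\<close>, the dimension of the feature space is \<open>CARD('p)\<close>, and
  \<open>x j\<close> is the \<open>j\<close>-th data point.
\<close>

definition data_matrix :: "('n \<Rightarrow> real ^ 'p) \<Rightarrow> real ^ 'p ^ 'n" where
  "data_matrix x = (\<chi> j. x j)"

definition sum_loss :: "('n::finite \<Rightarrow> real \<Rightarrow> real) \<Rightarrow> real ^ 'n \<Rightarrow> real" where
  "sum_loss l s = (\<Sum>j\<in>UNIV. l j (s $ j))"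

definition sum_loss_conj :: "('n::finite \<Rightarrow> real \<Rightarrow> real) \<Rightarrow> real ^ 'n \<Rightarrow> ereal" where
  "sum_loss_conj l w = (\<Sum>j\<in>UNIV. conjugate (l j) (w $ j))"

definition dual_ref :: "('n::finite \<Rightarrow> real \<Rightarrow> real) \<Rightarrow> real ^ 'n \<Rightarrow> ereal" where
  "dual_ref l w = ereal (1 / real CARD('n)) * (\<Sum>j\<in>UNIV. conjugate (l j) (w $ j))"

text \<open>
  The averages \<open>\<beta>bar\<close> are stored for indices \<open>i \<ge> 0\<close>; the initial value \<open>\<beta>bar\<close> at index \<open>-1\<close>
  is the constant \<open>0\<close>.
\<close>

definition averages ::
    "(nat \<Rightarrow> real) \<Rightarrow> (nat \<Rightarrow> real ^ 'p) \<Rightarrow> (nat \<Rightarrow> real ^ 'p) \<Rightarrow> bool" where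
  "averages \<alpha> \<beta>t \<beta>bar \<longleftrightarrow>
     (\<forall>i. \<beta>bar i =
        (1 - \<alpha> i) *\<^sub>R (case i of 0 \<Rightarrow> 0 | Suc k \<Rightarrow> \<beta>bar k) + \<alpha> i *\<^sub>R \<beta>t i)"

text \<open>Stochastic generalized Frank-Wolfe with substitute gradient.\<close>

definition sgfw_iterates ::
    "('n::finite \<Rightarrow> real ^ 'p) \<Rightarrow> ('n \<Rightarrow> real \<Rightarrow> real) \<Rightarrow> (real ^ 'p \<Rightarrow> ereal) \<Rightarrow>
     (nat \<Rightarrow> real) \<Rightarrow> (nat \<Rightarrow> real) \<Rightarrow> (nat \<Rightarrow> 'n) \<Rightarrow>
     (nat \<Rightarrow> real ^ 'n) \<Rightarrow> (nat \<Rightarrow> real ^ 'p) \<Rightarrow> (nat \<Rightarrow> real ^ 'p) \<Rightarrow> (nat \<Rightarrow> real ^ 'p) \<Rightarrow> bool" where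
  "sgfw_iterates x l R \<alpha> \<eta> j s d \<beta>t \<beta>bar \<longleftrightarrow>
     s 0 = 0 \<and>
     d 0 = (1 / real CARD('n)) *\<^sub>R (transpose (data_matrix x) *v grad (sum_loss l) (s 0)) \<and>
     (\<forall>i. \<beta>t i \<in> argmin_set (\<lambda>\<beta>. ereal (d i \<bullet> \<beta>) + R \<beta>)) \<and>
     (\<forall>i. s (Suc i) $ j i = (1 - \<eta> i) * s i $ j i + \<eta> i * (x (j i) \<bullet> \<beta>t i)) \<and>
     (\<forall>i k. k \<noteq> j i \<longrightarrow> s (Suc i) $ k = s i $ k) \<and>
     (\<forall>i. d (Suc i) =
        (1 / real CARD('n)) *\<^sub>R (transpose (data_matrix x) *v grad (sum_loss l) (s (Suc i)))) \<and>
     (\<forall>i. d (Suc i) = d i + ((1 / real CARD('n)) *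
        (deriv (l (j i)) (s (Suc i) $ j i) - deriv (l (j i)) (s i $ j i))) *\<^sub>R x (j i)) \<and>
     averages \<alpha> \<beta>t \<beta>bar"

text \<open>
  Randomized coordinate mirror descent on the dual. An update written \<open>w = argmin f\<close> is encoded as
  \<open>argmin_set f = {w}\<close>, i.e. \<open>w\<close> is the unique minimizer.
\<close>

definition coord_grad ::
    "('n::finite \<Rightarrow> real ^ 'p) \<Rightarrow> ('n \<Rightarrow> real \<Rightarrow> real) \<Rightarrow> 'n \<Rightarrow> real ^ 'n \<Rightarrow> real ^ 'p \<Rightarrow> real ^ 'n" where
  "coord_grad x l k w \<beta> =
     ((1 / real CARD('n)) * (x k \<bullet> \<beta> - ederiv (conjugate (l k)) (w $ k))) *\<^sub>R axis k 1"

definition rcmd_iterates ::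
    "('n::finite \<Rightarrow> real ^ 'p) \<Rightarrow> ('n \<Rightarrow> real \<Rightarrow> real) \<Rightarrow> (real ^ 'p \<Rightarrow> ereal) \<Rightarrow>
     (nat \<Rightarrow> real) \<Rightarrow> (nat \<Rightarrow> real) \<Rightarrow> (nat \<Rightarrow> 'n) \<Rightarrow>
     (nat \<Rightarrow> real ^ 'n) \<Rightarrow> (nat \<Rightarrow> real ^ 'p) \<Rightarrow> (nat \<Rightarrow> real ^ 'p) \<Rightarrow> bool" where
  "rcmd_iterates x l R \<alpha> \<eta> j w \<beta>t \<beta>bar \<longleftrightarrow>
     argmin_set (dual_ref l) = {w 0} \<and>
     (\<forall>i. \<beta>t i \<in> argmin_set
        (\<lambda>\<beta>. ereal ((1 / real CARD('n)) * (w i \<bullet> (data_matrix x *v \<beta>))) + R \<beta>)) \<and>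
     (\<forall>i. argmin_set (\<lambda>v. ereal ((- \<eta> i *\<^sub>R coord_grad x l (j i) (w i) (\<beta>t i)) \<bullet> (v - w i))
        + bregman (dual_ref l) v (w i)) = {w (Suc i)}) \<and>
     averages \<alpha> \<beta>t \<beta>bar"

end

theory Submission
  imports Defs
begin

text \<open>
  For a strictly convex smooth loss \<open>f\<close>, Fenchel's inequality \<open>f\<^sup>*(y) \<ge> y a - f(a)\<close> holds with
  equality exactly when \<open>y = f'(a)\<close>. Summed over the coordinates this says that, for every \<open>b\<close>, the
  function \<open>h(v) - \<langle>v, b\<rangle> / n\<close> has the unique minimizer \<open>\<nabla>L(b)\<close>
  (\<open>argmin_set_tilted_dual_ref\<close>). It also makes \<open>\<nabla>L\<^sup>*\<close> a left inverse of \<open>\<nabla>L\<close>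
  (\<open>egrad_sum_loss_conj_grad\<close>), because \<open>f\<^sup>*\<close> is differentiable at \<open>f'(a)\<close> with derivative \<open>a\<close>
  (\<open>conjugate_has_deriv\<close>).

  Hence \<open>w\<^sup>0 = \<nabla>L(0)\<close>. If \<open>w = \<nabla>L(s)\<close>, then \<open>\<nabla>h(w) = s / n\<close>, so the objective of the mirror
  descent step is, up to an additive constant, \<open>h(v) - \<langle>v, b\<rangle> / n\<close> with
  \<open>b = s + \<eta> (x\<^sub>k \<cdot> \<beta> - s\<^sub>k) e\<^sub>k\<close>. This \<open>b\<close> is exactly the next Frank-Wolfe point, and the mirror step
  returns \<open>\<nabla>L(b)\<close> (\<open>argmin_set_mirror_step\<close>). So the two recursions are conjugate to one another
  under \<open>\<nabla>L\<close>. The linear subproblems agree because \<open>\<langle>X\<^sup>T w, \<beta>\<rangle> = \<langle>w, X \<beta>\<rangle>\<close>.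
\<close>

section \<open>Strictly convex smooth functions of one variable\<close>

lemma smooth_with_has_deriv:
  assumes "smooth_with \<gamma> f"
  shows "(f has_real_derivative deriv f a) (at a)"
  using assms unfolding smooth_with_def
  by (simp add: DERIV_deriv_iff_real_differentiable)

lemma smooth_with_isCont_deriv:
  assumes "smooth_with \<gamma> f"
  shows "isCont (deriv f) a"
proof -
  have "((\<lambda>b. deriv f b - deriv f a) \<longlongrightarrow> 0) (at a)"
  proof (rule Lim_null_comparison)
    show "\<forall>\<^sub>F b in at a. norm (deriv f b - deriv f a) \<le> \<gamma> * \<bar>b - a\<bar>"
      using assms by (simp add: smooth_with_def)
    show "((\<lambda>b. \<gamma> * \<bar>b - a\<bar>) \<longlongrightarrow> 0) (at a)"
      by (rule tendsto_eq_intros refl | simp)+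
  qed
  then show ?thesis
    by (simp add: isCont_def LIM_zero_iff)
qed

lemma strictly_convex_above_tangent:
  assumes "strictly_convex f" and "smooth_with \<gamma> f"
  shows "f b \<ge> f a + deriv f a * (b - a)"
proof -
  have "convex_on UNIV f"
  proof (rule convex_onI)
    fix t a b :: real
    assume "0 < t" "t < 1"
    then show "f ((1 - t) *\<^sub>R a + t *\<^sub>R b) \<le> (1 - t) * f a + t * f b"
      using assms(1) by (cases "a = b") (auto simp: strictly_convex_def algebra_simps less_imp_le)
  qed simp
  then have "f b - f a \<ge> deriv f a * (b - a)"
    using smooth_with_has_deriv[OF assms(2)]
    by (intro convex_on_imp_above_tangent[where A = UNIV]) auto
  then show ?thesis by simp
qed

lemma strictly_convex_deriv_less:
  assumes "strictly_convex f" and "smooth_with \<gamma> f" and "a < b"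
  shows "deriv f a < deriv f b"
proof (rule ccontr)
  assume "\<not> deriv f a < deriv f b"
  define A B where "A = deriv f a * (b - a)" and "B = deriv f b * (b - a)"
  have le: "B \<le> A"
    unfolding A_def B_def using \<open>\<not> deriv f a < deriv f b\<close> \<open>a < b\<close> by (intro mult_right_mono) auto
  define m where "m = a / 2 + b / 2"
  have mid: "f m < f a / 2 + f b / 2"
    using assms(1)[unfolded strictly_convex_def, rule_format, of a b "1/2"] \<open>a < b\<close>
    by (simp add: m_def)
  have ba: "f a \<ge> f b + deriv f b * (a - b)"
    and am: "f m \<ge> f a + deriv f a * (m - a)"
    using strictly_convex_above_tangent[OF assms(1,2)] by blast+
  have eq: "deriv f a * (m - a) = A / 2" "deriv f b * (a - b) = - B"
    by (simp_all add: m_def A_def B_def field_simps)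
  show False
    using mid ba am le unfolding eq by linarith
qed

section \<open>Conjugates\<close>

lemma conjugate_ge: "ereal (y \<bullet> a - f a) \<le> conjugate f y"
  unfolding conjugate_def by (rule SUP_upper) simp

lemma conjugate_not_MInfty: "conjugate f y \<noteq> -\<infinity>"
  using conjugate_ge[of y 0 f] by auto

lemma conjugate_deriv:
  assumes "strictly_convex f" and "smooth_with \<gamma> f"
  shows "conjugate f (deriv f a) = ereal (deriv f a * a - f a)"
proof (rule antisym)
  show "conjugate f (deriv f a) \<le> ereal (deriv f a * a - f a)"
    unfolding conjugate_def
  proof (rule SUP_least)
    fix b
    show "ereal (deriv f a \<bullet> b - f b) \<le> ereal (deriv f a * a - f a)"
      using strictly_convex_above_tangent[OF assms, of a b] by (simp add: algebra_simps)
  qed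
  show "ereal (deriv f a * a - f a) \<le> conjugate f (deriv f a)"
    using conjugate_ge[of "deriv f a" a f] by simp
qed

lemma conjugate_gt:
  assumes "smooth_with \<gamma> f" and "y \<noteq> deriv f a"
  shows "ereal (y * a - f a) < conjugate f y"
proof (rule ccontr)
  assume "\<not> ?thesis"
  then have le: "conjugate f y \<le> ereal (y * a - f a)" by simp
  \<comment> \<open>Then \<open>b \<mapsto> y b - f(b)\<close> is maximal at \<open>a\<close>, so its derivative vanishes there.\<close>
  have max: "y * b - f b \<le> y * a - f a" for b
    using order_trans[OF conjugate_ge[of y b f] le] by simp
  have "((\<lambda>b. y * b - f b) has_real_derivative (y - deriv f a)) (at a)"
    using smooth_with_has_deriv[OF assms(1)] by (auto intro!: derivative_eq_intros)
  then have "y - deriv f a = 0"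
    by (rule DERIV_local_max[where d = 1]) (use max in auto)
  with assms(2) show False by simp
qed

text \<open>
  Every \<open>y\<close> close to \<open>f'(a)\<close> is some \<open>f'(s)\<close> with \<open>s\<close> close to \<open>a\<close>, since \<open>f'\<close> is continuous and
  strictly increasing.
\<close>

lemma eventually_nhds_deriv_image:
  assumes "strictly_convex f" and "smooth_with \<gamma> f" and "0 < e"
  shows "\<forall>\<^sub>F y in nhds (deriv f a). \<exists>s. \<bar>s - a\<bar> \<le> e \<and> y = deriv f s"
proof -
  have "deriv f (a - e) < deriv f a" "deriv f a < deriv f (a + e)"
    using strictly_convex_deriv_less[OF assms(1,2)] \<open>0 < e\<close> by auto
  then have "\<forall>\<^sub>F y in nhds (deriv f a). y \<in> {deriv f (a - e)<..<deriv f (a + e)}"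
    by (intro eventually_nhds_in_open) auto
  then show ?thesis
  proof eventually_elim
    case (elim y)
    then obtain s where "a - e \<le> s" "s \<le> a + e" "deriv f s = y"
      using IVT[of "deriv f" "a - e" y "a + e"] smooth_with_isCont_deriv[OF assms(2)] \<open>0 < e\<close>
      by auto
    then show ?case by (intro exI[of _ s]) auto
  qed
qed

lemma eventually_nhds_conjugate_finite:
  assumes "strictly_convex f" and "smooth_with \<gamma> f"
  shows "\<forall>\<^sub>F y in nhds (deriv f a). \<bar>conjugate f y\<bar> \<noteq> \<infinity>"
  using eventually_nhds_deriv_image[OF assms zero_less_one]
  by eventually_elim (use conjugate_deriv[OF assms] in auto)

text \<open>
  Two uses of Fenchel's inequality bound the error of the linear approximation of \<open>f\<^sup>*\<close> at \<open>f'(a)\<close>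
  with slope \<open>a\<close>: for \<open>y = f'(s)\<close> it lies between \<open>0\<close> and \<open>(s - a) (y - f'(a))\<close>.
\<close>

lemma conjugate_has_deriv:
  assumes "strictly_convex f" and "smooth_with \<gamma> f"
  shows "((\<lambda>y. real_of_ereal (conjugate f y)) has_real_derivative a) (at (deriv f a))"
  unfolding has_field_derivative_def has_derivative_at_alt
proof (intro conjI allI impI)
  show "bounded_linear ((*) a)" by (rule bounded_linear_mult_right)
  fix e :: real
  assume "0 < e"
  let ?c = "\<lambda>y. real_of_ereal (conjugate f y)" and ?y0 = "deriv f a"
  have err: "norm (?c y - ?c ?y0 - a * (y - ?y0)) \<le> e * norm (y - ?y0)"
    if s: "\<bar>s - a\<bar> \<le> e" "y = deriv f s" for s y
  proof -
    have c: "?c y = y * s - f s" "?c ?y0 = ?y0 * a - f a"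
      using conjugate_deriv[OF assms] s(2) by simp_all
    have "y * a - f a \<le> ?c y"
      using conjugate_ge[of y a f] conjugate_deriv[OF assms, of s] s(2) by simp
    then have lower: "0 \<le> ?c y - ?c ?y0 - a * (y - ?y0)"
      using c by (simp add: algebra_simps)
    have "?y0 * s - f s \<le> ?c ?y0"
      using conjugate_ge[of ?y0 s f] conjugate_deriv[OF assms, of a] by simp
    then have "?c y - ?c ?y0 - a * (y - ?y0) \<le> (s - a) * (y - ?y0)"
      using c by (simp add: algebra_simps)
    also have "\<dots> \<le> \<bar>s - a\<bar> * \<bar>y - ?y0\<bar>"
      by (metis abs_ge_self abs_mult)
    also have "\<dots> \<le> e * \<bar>y - ?y0\<bar>"
      using s(1) by (rule mult_right_mono) simp
    finally show ?thesis using lower by simp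
  qed
  have "\<forall>\<^sub>F y in nhds ?y0. norm (?c y - ?c ?y0 - a * (y - ?y0)) \<le> e * norm (y - ?y0)"
    using eventually_nhds_deriv_image[OF assms \<open>0 < e\<close>] by eventually_elim (use err in blast)
  then show "\<exists>d>0. \<forall>y. norm (y - ?y0) < d \<longrightarrow>
      norm (?c y - ?c ?y0 - a * (y - ?y0)) \<le> e * norm (y - ?y0)"
    by (simp add: eventually_nhds_metric dist_norm)
qed

lemma ederiv_conjugate_deriv:
  assumes "strictly_convex f" and "smooth_with \<gamma> f"
  shows "ederiv (conjugate f) (deriv f a) = a"
  unfolding ederiv_def by (rule DERIV_imp_deriv[OF conjugate_has_deriv[OF assms]])

section \<open>Gradients of separable functions\<close>

lemma grad_eqI:
  assumes "GDERIV f v :> D"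
  shows "grad f v = D"
  unfolding grad_def
proof (rule the_equality)
  fix D'
  assume "GDERIV f v :> D'"
  with assms have "(\<lambda>h. h \<bullet> D) = (\<lambda>h. h \<bullet> D')"
    unfolding gderiv_def by (rule has_derivative_unique)
  then have "\<forall>h. h \<bullet> D' = h \<bullet> D"
    by (simp add: fun_eq_iff)
  then show "D' = D"
    by (simp only: vector_eq_ldot)
qed (rule assms)

lemma gderiv_separable:
  fixes v :: "real ^ 'n::finite"
  assumes "\<And>k. (f k has_real_derivative D $ k) (at (v $ k))"
  shows "GDERIV (\<lambda>v. \<Sum>k\<in>UNIV. f k (v $ k)) v :> D"
proof -
  have "((\<lambda>v. f k (v $ k)) has_derivative (\<lambda>h. D $ k * h $ k)) (at v)" for k
    using has_derivative_compose[OF bounded_linear_imp_has_derivative[OF bounded_linear_vec_nth]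
        assms[of k, unfolded has_field_derivative_def]]
    by simp
  then have "((\<lambda>v. \<Sum>k\<in>UNIV. f k (v $ k)) has_derivative (\<lambda>h. \<Sum>k\<in>UNIV. D $ k * h $ k)) (at v)"
    by (intro has_derivative_sum)
  then show ?thesis
    by (simp add: gderiv_def inner_vec_def mult.commute)
qed

lemma grad_sum_loss:
  assumes "\<And>k. smooth_with \<gamma> (l k)"
  shows "grad (sum_loss l) s = (\<chi> k. deriv (l k) (s $ k))"
  unfolding sum_loss_def
  by (intro grad_eqI gderiv_separable) (simp add: smooth_with_has_deriv[OF assms])

text \<open>
  The range of each \<open>l\<^sub>k'\<close> is a neighbourhood of each of its points. So all conjugates are finite near
  \<open>\<nabla>L(s)\<close>, where the conversion to real numbers therefore commutes with the sum.
\<close>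

lemma gderiv_sum_loss_conj:
  fixes l :: "'n::finite \<Rightarrow> real \<Rightarrow> real"
  assumes "\<And>k. strictly_convex (l k)" and "\<And>k. smooth_with \<gamma> (l k)"
  shows "GDERIV (\<lambda>v. real_of_ereal (sum_loss_conj l v)) (grad (sum_loss l) s) :> s"
proof -
  let ?w = "grad (sum_loss l) s"
  let ?g = "\<lambda>v::real^'n. \<Sum>k\<in>UNIV. real_of_ereal (conjugate (l k) (v $ k))"
  have w: "?w $ k = deriv (l k) (s $ k)" for k
    by (simp add: grad_sum_loss[OF assms(2)])
  have g: "GDERIV ?g ?w :> s"
    by (intro gderiv_separable) (simp add: w conjugate_has_deriv[OF assms])
  have "\<forall>\<^sub>F v in nhds ?w. \<bar>conjugate (l k) (v $ k)\<bar> \<noteq> \<infinity>" for k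
  proof -
    have "((\<lambda>v. v $ k) \<longlongrightarrow> ?w $ k) (nhds ?w)"
      by (rule tendsto_vec_nth[OF filterlim_ident])
    then show ?thesis
      using eventually_nhds_conjugate_finite[OF assms, of k "s $ k"]
      unfolding w by (rule eventually_compose_filterlim[rotated])
  qed
  then have "\<forall>\<^sub>F v in nhds ?w. \<forall>k. \<bar>conjugate (l k) (v $ k)\<bar> \<noteq> \<infinity>"
    by (rule eventually_all_finite)
  then have eq: "\<forall>\<^sub>F v in nhds ?w. ?g v = real_of_ereal (sum_loss_conj l v)"
  proof eventually_elim
    case (elim v)
    then have "conjugate (l k) (v $ k) = ereal (real_of_ereal (conjugate (l k) (v $ k)))" for k
      by (simp add: ereal_real')
    then have "sum_loss_conj l v = ereal (?g v)"
      unfolding sum_loss_conj_def by (metis (no_types, lifting) sum.cong sum_ereal)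
    then show ?case by simp
  qed
  then have "\<forall>\<^sub>F v in at ?w. ?g v = real_of_ereal (sum_loss_conj l v)"
    by (auto simp: eventually_at_filter elim: eventually_mono)
  then show ?thesis
    using has_derivative_transform_eventually[OF g[unfolded gderiv_def]]
      eventually_nhds_x_imp_x[OF eq]
    by (simp add: gderiv_def)
qed

lemma egrad_sum_loss_conj_grad:
  assumes "\<And>k. strictly_convex (l k)" and "\<And>k. smooth_with \<gamma> (l k)"
  shows "egrad (sum_loss_conj l) (grad (sum_loss l) s) = s"
  unfolding egrad_def by (rule grad_eqI[OF gderiv_sum_loss_conj[OF assms]])

lemma dual_ref_eq:
  fixes l :: "'n::finite \<Rightarrow> real \<Rightarrow> real"
  shows "dual_ref l v = ereal (1 / real CARD('n)) * sum_loss_conj l v"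
  by (simp add: dual_ref_def sum_loss_conj_def)

lemma egrad_dual_ref_grad:
  fixes l :: "'n::finite \<Rightarrow> real \<Rightarrow> real"
  assumes "\<And>k. strictly_convex (l k)" and "\<And>k. smooth_with \<gamma> (l k)"
  shows "egrad (dual_ref l) (grad (sum_loss l) s) = (1 / real CARD('n)) *\<^sub>R s"
  unfolding egrad_def
proof (rule grad_eqI)
  have "((\<lambda>v. 1 / real CARD('n) * real_of_ereal (sum_loss_conj l v)) has_derivative
      (\<lambda>h. 1 / real CARD('n) * (h \<bullet> s))) (at (grad (sum_loss l) s))"
    using gderiv_sum_loss_conj[OF assms, unfolded gderiv_def] by (rule has_derivative_mult_right)
  then show "GDERIV (\<lambda>v. real_of_ereal (dual_ref l v)) (grad (sum_loss l) s) :>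
      (1 / real CARD('n)) *\<^sub>R s"
    by (simp add: gderiv_def dual_ref_eq)
qed

section \<open>Minimizing the tilted dual reference function\<close>

lemma sum_loss_conj_grad:
  fixes l :: "'n::finite \<Rightarrow> real \<Rightarrow> real"
  assumes "\<And>k. strictly_convex (l k)" and "\<And>k. smooth_with \<gamma> (l k)"
  shows "sum_loss_conj l (grad (sum_loss l) b) = ereal (grad (sum_loss l) b \<bullet> b - sum_loss l b)"
  unfolding sum_loss_conj_def sum_loss_def[of l b]
  by (simp add: grad_sum_loss[OF assms(2)] conjugate_deriv[OF assms] inner_vec_def sum_subtractf)

text \<open>
  Strictness of Fenchel's inequality away from \<open>\<nabla>L(b)\<close>, for all \<open>v\<close> including those with
  \<open>L\<^sup>*(v) = \<infinity>\<close>.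
\<close>

lemma sum_loss_conj_gt:
  fixes l :: "'n::finite \<Rightarrow> real \<Rightarrow> real"
  assumes "\<And>k. smooth_with \<gamma> (l k)" and "v \<noteq> grad (sum_loss l) b"
  shows "ereal (v \<bullet> b - sum_loss l b) < sum_loss_conj l v"
proof (cases "\<exists>k. conjugate (l k) (v $ k) = \<infinity>")
  case True
  then have "sum_loss_conj l v = \<infinity>"
    unfolding sum_loss_conj_def by (simp add: sum_Pinfty)
  then show ?thesis by simp
next
  case False
  define r where "r k = real_of_ereal (conjugate (l k) (v $ k))" for k
  have r: "conjugate (l k) (v $ k) = ereal (r k)" for k
    using False conjugate_not_MInfty[of "l k" "v $ k"] by (auto simp: r_def ereal_real)
  obtain k where k: "v $ k \<noteq> deriv (l k) (b $ k)"
    using assms(2) by (auto simp: grad_sum_loss[OF assms(1)] vec_eq_iff)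
  have "(\<Sum>k\<in>UNIV. v $ k * b $ k - l k (b $ k)) < (\<Sum>k\<in>UNIV. r k)"
  proof (rule sum_strict_mono_ex1)
    show "\<forall>k\<in>UNIV. v $ k * b $ k - l k (b $ k) \<le> r k"
    proof
      fix k
      show "v $ k * b $ k - l k (b $ k) \<le> r k"
        using conjugate_ge[of "v $ k" "b $ k" "l k"] r[of k] by simp
    qed
    show "\<exists>k\<in>UNIV. v $ k * b $ k - l k (b $ k) < r k"
      using conjugate_gt[OF assms(1) k] r[of k] by auto
  qed simp
  then show ?thesis
    by (simp add: sum_loss_conj_def sum_loss_def r inner_vec_def sum_subtractf)
qed

lemma argmin_set_eq_singletonI:
  assumes "\<And>v. v \<noteq> m \<Longrightarrow> F m < F v"
  shows "argmin_set F = {m}"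
proof -
  have "\<not> F v < F m" for v
    using assms[of v] by (cases "v = m") auto
  then show ?thesis
    using assms by (auto simp: argmin_set_def is_arg_min_def)
qed

lemma argmin_set_tilted_dual_ref:
  fixes l :: "'n::finite \<Rightarrow> real \<Rightarrow> real"
  assumes "\<And>k. strictly_convex (l k)" and "\<And>k. smooth_with \<gamma> (l k)"
  shows "argmin_set (\<lambda>v. ereal (c - (1 / real CARD('n)) * (v \<bullet> b)) + dual_ref l v)
    = {grad (sum_loss l) b}"
proof (rule argmin_set_eq_singletonI)
  fix v
  assume v: "v \<noteq> grad (sum_loss l) b"
  let ?N = "1 / real CARD('n)" and ?m = "grad (sum_loss l) b"
  have pos: "0 < ?N" by simp
  have "ereal (c - ?N * (?m \<bullet> b)) + dual_ref l ?m = ereal (c - ?N * sum_loss l b)"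
    by (simp add: dual_ref_eq sum_loss_conj_grad[OF assms] field_simps)
  also have "\<dots> < ereal (c - ?N * (v \<bullet> b)) + dual_ref l v"
  proof (cases "sum_loss_conj l v")
    case (real r)
    then have "?N * (v \<bullet> b - sum_loss l b) < ?N * r"
      using sum_loss_conj_gt[OF assms(2) v] pos by (intro mult_strict_left_mono) auto
    then show ?thesis
      by (simp add: dual_ref_eq real diff_divide_distrib)
  qed (use sum_loss_conj_gt[OF assms(2) v] in \<open>auto simp: dual_ref_eq\<close>)
  finally show "ereal (c - ?N * (?m \<bullet> b)) + dual_ref l ?m
      < ereal (c - ?N * (v \<bullet> b)) + dual_ref l v" .
qed

section \<open>The two recursions\<close>

lemma argmin_set_dual_ref:
  fixes l :: "'n::finite \<Rightarrow> real \<Rightarrow> real"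
  assumes "\<And>k. strictly_convex (l k)" and "\<And>k. smooth_with \<gamma> (l k)"
  shows "argmin_set (dual_ref l) = {grad (sum_loss l) 0}"
  using argmin_set_tilted_dual_ref[OF assms, where c = 0 and b = 0]
  by simp

text \<open>The Frank-Wolfe update of coordinate \<open>k\<close>, with step-size \<open>e\<close> and predicted value \<open>a\<close>.\<close>

definition coord_step :: "'n \<Rightarrow> real \<Rightarrow> real \<Rightarrow> real ^ 'n \<Rightarrow> real ^ 'n::finite" where
  "coord_step k e a s = s + (e * (a - s $ k)) *\<^sub>R axis k 1"

lemma coord_step_iff:
  "s' = coord_step k e a s \<longleftrightarrow>
    s' $ k = (1 - e) * s $ k + e * a \<and> (\<forall>i. i \<noteq> k \<longrightarrow> s' $ i = s $ i)"
proof -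
  have "coord_step k e a s $ i = (if i = k then (1 - e) * s $ k + e * a else s $ i)" for i
    by (simp add: coord_step_def axis_def algebra_simps)
  then show ?thesis
    unfolding vec_eq_iff by metis
qed

text \<open>
  Since \<open>\<nabla>h(w) = s / n\<close>, the linear part of the objective at \<open>v\<close> is
  \<open>- \<langle>v, (\<nabla>h(w) + e g)\<rangle>\<close> up to a constant, where \<open>g\<close> is the coordinate gradient, and
  \<open>n (\<nabla>h(w) + e g)\<close> is the updated vector.
\<close>

lemma argmin_set_mirror_step:
  fixes l :: "'n::finite \<Rightarrow> real \<Rightarrow> real" and x :: "'n \<Rightarrow> real ^ 'p"
  assumes "\<And>k. strictly_convex (l k)" and "\<And>k. smooth_with \<gamma> (l k)"
    and "w = grad (sum_loss l) s"
  shows "argmin_set (\<lambda>v. ereal ((- e *\<^sub>R coord_grad x l k w \<beta>) \<bullet> (v - w)) + bregman (dual_ref l) v w)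
    = {grad (sum_loss l) (coord_step k e (x k \<bullet> \<beta>) s)}"
proof -
  let ?N = "1 / real CARD('n)" and ?a = "x k \<bullet> \<beta>"
  let ?b = "coord_step k e ?a s"
  obtain H where H: "dual_ref l w = ereal H"
    using sum_loss_conj_grad[OF assms(1,2), where b = s] by (simp add: dual_ref_eq assms(3))
  have "ederiv (conjugate (l k)) (w $ k) = s $ k"
    by (simp add: assms(3) grad_sum_loss[OF assms(2)] ederiv_conjugate_deriv[OF assms(1,2)])
  then have cg: "coord_grad x l k w \<beta> = (?N * (?a - s $ k)) *\<^sub>R axis k 1"
    by (simp add: coord_grad_def)
  have eg: "egrad (dual_ref l) w = ?N *\<^sub>R s"
    unfolding assms(3) by (rule egrad_dual_ref_grad[OF assms(1,2)])
  define c where "c = ?N * (w \<bullet> ?b) - H"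
  have "ereal ((- e *\<^sub>R coord_grad x l k w \<beta>) \<bullet> (v - w)) + bregman (dual_ref l) v w
      = ereal (c - ?N * (v \<bullet> ?b)) + dual_ref l v" for v
  proof -
    have "(- e *\<^sub>R coord_grad x l k w \<beta>) \<bullet> (v - w)
        = - (?N * ((v - w) \<bullet> ((e * (?a - s $ k)) *\<^sub>R axis k 1)))"
      unfolding cg by (simp add: inner_commute[of "axis k 1"])
    then have "(- e *\<^sub>R coord_grad x l k w \<beta>) \<bullet> (v - w) - H - (?N *\<^sub>R s) \<bullet> (v - w)
        = - (?N * ((v - w) \<bullet> ?b)) - H"
      unfolding coord_step_def inner_add_right
      by (simp add: inner_commute[of s] add_divide_distrib)
    also have "\<dots> = c - ?N * (v \<bullet> ?b)"
      by (simp add: c_def inner_diff_left diff_divide_distrib)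
    finally have "(- e *\<^sub>R coord_grad x l k w \<beta>) \<bullet> (v - w) - H - (?N *\<^sub>R s) \<bullet> (v - w)
        = c - ?N * (v \<bullet> ?b)" .
    then show ?thesis
      unfolding bregman_def H eg by (cases "dual_ref l v") auto
  qed
  then show ?thesis
    using argmin_set_tilted_dual_ref[OF assms(1,2), where c = c and b = ?b] by simp
qed

lemma linear_subproblem_eq:
  fixes X :: "real ^ 'p ^ 'n"
  shows "(c *\<^sub>R (transpose X *v w)) \<bullet> \<beta> = c * (w \<bullet> (X *v \<beta>))"
  by (simp add: dot_lmul_matrix)

lemma transpose_data_matrix_diff:
  assumes "\<And>i. i \<noteq> k \<Longrightarrow> w' $ i = w $ i"
  shows "transpose (data_matrix x) *v w' = transpose (data_matrix x) *v w + (w' $ k - w $ k) *\<^sub>R x k"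
proof -
  have "w' - w = (w' $ k - w $ k) *\<^sub>R axis k 1"
    using assms by (auto simp: vec_eq_iff axis_def)
  then have "transpose (data_matrix x) *v (w' - w) = (w' $ k - w $ k) *\<^sub>R x k"
    by (simp add: matrix_vector_mult_scaleR matrix_vector_mult_basis column_transpose row_def
        data_matrix_def)
  then show ?thesis
    by (simp add: matrix_vector_mult_diff_distrib algebra_simps)
qed

lemma sgfw_imp_rcmd:
  fixes x :: "'n::finite \<Rightarrow> real ^ 'p"
  assumes "\<And>k. strictly_convex (l k)" and "\<And>k. smooth_with \<gamma> (l k)"
    and "sgfw_iterates x l R \<alpha> \<eta> j s d \<beta>t \<beta>bar"
  shows "rcmd_iterates x l R \<alpha> \<eta> j (\<lambda>i. grad (sum_loss l) (s i)) \<beta>t \<beta>bar"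
proof -
  note fw = assms(3)[unfolded sgfw_iterates_def]
  have d: "d i = (1 / real CARD('n)) *\<^sub>R (transpose (data_matrix x) *v grad (sum_loss l) (s i))" for i
    using fw by (cases i) auto
  have step: "s (Suc i) = coord_step (j i) (\<eta> i) (x (j i) \<bullet> \<beta>t i) (s i)" for i
    using fw by (auto simp: coord_step_iff)
  have "\<beta>t i \<in> argmin_set (\<lambda>\<beta>. ereal ((1 / real CARD('n)) *
      (grad (sum_loss l) (s i) \<bullet> (data_matrix x *v \<beta>))) + R \<beta>)" for i
    using fw unfolding d linear_subproblem_eq by blast
  then show ?thesis
    unfolding rcmd_iterates_def step argmin_set_mirror_step[OF assms(1,2) refl]
      argmin_set_dual_ref[OF assms(1,2)]
    using fw by simp
qed

lemma rcmd_imp_sgfw: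
  fixes x :: "'n::finite \<Rightarrow> real ^ 'p"
  assumes "\<And>k. strictly_convex (l k)" and "\<And>k. smooth_with \<gamma> (l k)"
    and "rcmd_iterates x l R \<alpha> \<eta> j w \<beta>t \<beta>bar"
  shows "sgfw_iterates x l R \<alpha> \<eta> j (\<lambda>i. egrad (sum_loss_conj l) (w i))
    (\<lambda>i. (1 / real CARD('n)) *\<^sub>R (transpose (data_matrix x) *v w i)) \<beta>t \<beta>bar"
proof -
  define s where "s i = egrad (sum_loss_conj l) (w i)" for i
  define X where "X = data_matrix x"
  note inverse = egrad_sum_loss_conj_grad[where l = l, OF assms(1,2)]
  note md = assms(3)[unfolded rcmd_iterates_def]
  have step_w: "w (Suc i) = grad (sum_loss l) (coord_step (j i) (\<eta> i) (x (j i) \<bullet> \<beta>t i) u)"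
    if "w i = grad (sum_loss l) u" for i u
    using md argmin_set_mirror_step[OF assms(1,2) that, of "\<eta> i" x "j i" "\<beta>t i"] by simp
  have w0: "w 0 = grad (sum_loss l) 0"
    using md argmin_set_dual_ref[where l = l, OF assms(1,2)] by simp
  \<comment> \<open>All dual iterates stay in the range of \<open>\<nabla>L\<close>, where \<open>\<nabla>L\<^sup>*\<close> inverts \<open>\<nabla>L\<close>.\<close>
  have "\<exists>u. w i = grad (sum_loss l) u" for i
    by (induction i) (use w0 step_w in blast)+
  then have w: "w i = grad (sum_loss l) (s i)" for i
    using inverse s_def by metis
  have s0: "s 0 = 0"
    unfolding s_def w0 by (rule inverse)
  have "s (Suc i) = coord_step (j i) (\<eta> i) (x (j i) \<bullet> \<beta>t i) (s i)" for i
    unfolding s_def[of "Suc i"] step_w[OF w] by (rule inverse)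
  then have s: "s (Suc i) $ j i = (1 - \<eta> i) * s i $ j i + \<eta> i * (x (j i) \<bullet> \<beta>t i)"
      "k \<noteq> j i \<Longrightarrow> s (Suc i) $ k = s i $ k" for i k
    by (auto simp: coord_step_iff)
  have wk: "w i $ k = deriv (l k) (s i $ k)" for i k
    by (simp add: w grad_sum_loss[where l = l, OF assms(2)])
  have X: "transpose X *v w (Suc i) = transpose X *v w i +
      (deriv (l (j i)) (s (Suc i) $ j i) - deriv (l (j i)) (s i $ j i)) *\<^sub>R x (j i)" for i
    unfolding X_def wk[symmetric] by (rule transpose_data_matrix_diff) (simp add: wk s)
  have "sgfw_iterates x l R \<alpha> \<eta> j s
    (\<lambda>i. (1 / real CARD('n)) *\<^sub>R (transpose X *v w i)) \<beta>t \<beta>bar"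
    unfolding sgfw_iterates_def X_def[symmetric] linear_subproblem_eq w[symmetric]
    using md s0 s X by (simp add: X_def[symmetric] scaleR_add_right)
  then show ?thesis
    by (simp add: s_def[abs_def] X_def)
qed

theorem lemma2p1:
  fixes x :: "'n::finite \<Rightarrow> real ^ 'p"
    and l :: "'n \<Rightarrow> real \<Rightarrow> real"
    and \<gamma> :: real
    and R :: "real ^ 'p \<Rightarrow> ereal"
    and \<alpha> \<eta> :: "nat \<Rightarrow> real"
    and j :: "nat \<Rightarrow> 'n"
  assumes loss_convex: "\<And>k. strictly_convex (l k)"
    and loss_smooth: "\<And>k. smooth_with \<gamma> (l k)"
    and R_proper: "\<And>\<beta>. R \<beta> \<noteq> -\<infinity>"
    and R_bounded: "bounded (eff_dom R)"
    and R_zero: "0 \<in> eff_dom R"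
    and R_attained: "\<And>c. argmin_set (\<lambda>\<beta>. ereal (c \<bullet> \<beta>) + R \<beta>) \<noteq> {}"
    and step_avg: "\<And>i. \<alpha> i \<in> {0<..1}"
    and step_eta: "\<And>i. \<eta> i \<in> {0<..1}"
  shows "(\<forall>s d \<beta>t \<beta>bar.
            sgfw_iterates x l R \<alpha> \<eta> j s d \<beta>t \<beta>bar \<longrightarrow>
            rcmd_iterates x l R \<alpha> \<eta> j (\<lambda>i. grad (sum_loss l) (s i)) \<beta>t \<beta>bar) \<and>
         (\<forall>w \<beta>t \<beta>bar.
            rcmd_iterates x l R \<alpha> \<eta> j w \<beta>t \<beta>bar \<longrightarrow>
            sgfw_iterates x l R \<alpha> \<eta> j
              (\<lambda>i. egrad (sum_loss_conj l) (w i))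
              (\<lambda>i. (1 / real CARD('n)) *\<^sub>R (transpose (data_matrix x) *v w i))
              \<beta>t \<beta>bar)"
  using sgfw_imp_rcmd[where l = l, OF loss_convex loss_smooth]
    rcmd_imp_sgfw[where l = l, OF loss_convex loss_smooth]
  by blast

end
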